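(* Let $(H;\langle\cdot,\cdot\rangle)$ be a real or complex inner product space and let $a\in H$ be a unit vector. Let $r,s>0$, $p\in(0,s]$, and $$D=\{x\in H:\ \|rx-sa\|\le p\}.$$ If $x_1,x_2\in D$ with $x_1\ne 0$ and $x_2\neq 0$, then $$\frac{\|x_1\|\|x_2\|-\operatorname{Re}\langle x_1,x_2\rangle}{(\|x_1\|+\|x_2\|)^2}\le\frac12\left(1-\left(\frac{r^2\|x_1\|^2-p^2+s^2}{2rs\|x_1\|}\right)^2\right)$$ or $$\frac{\|x_1\|\|x_2\|-\operatorname{Re}\langle x_1,x_2\rangle}{(\|x_1\|+\|x_2\|)^2}\le\frac12\left(1-\left(\frac{r^2\|x_2\|^2-p^2+s^2}{2rs\|x_2\|}\right)^2\right).$$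
   Context: $\|x\|=\langle x,x\rangle^{1/2}$ is the norm induced by the inner product; $\operatorname{Re}$ denotes the real part (in the real case $\operatorname{Re}\langle x,y\rangle=\langle x,y\rangle$). *)

theory Defs
  imports Complex_Main "HOL-Analysis.Inner_Product"
begin

(* The distribution only provides real_inner. This is its complex counterpart,
   with the inner product linear in the first argument and conjugate-symmetric.
   The library norm is restricted to real_normed_vector, so the induced norm is a
   separate constant cnorm. No completeness is assumed. *)

class complex_inner = ab_group_add +
  fixes scaleC :: "complex \<Rightarrow> 'a \<Rightarrow> 'a" (infixr "*\<^sub>C" 75)
    and cinner :: "'a \<Rightarrow> 'a \<Rightarrow> complex"
  assumes scaleC_add_right: "c *\<^sub>C (x + y) = c *\<^sub>C x + c *\<^sub>C y"
    and scaleC_add_left: "(c + d) *\<^sub>C x = c *\<^sub>C x + d *\<^sub>C x"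
    and scaleC_scaleC: "c *\<^sub>C d *\<^sub>C x = (c * d) *\<^sub>C x"
    and scaleC_one: "1 *\<^sub>C x = x"
    and cinner_commute: "cinner x y = cnj (cinner y x)"
    and cinner_add_left: "cinner (x + y) z = cinner x z + cinner y z"
    and cinner_scaleC_left: "cinner (c *\<^sub>C x) y = c * cinner x y"
    and cinner_ge_zero: "0 \<le> Re (cinner x x)"
    and cinner_eq_zero_iff: "cinner x x = 0 \<longleftrightarrow> x = 0"

definition cnorm :: "'a::complex_inner \<Rightarrow> real"
  where "cnorm x = sqrt (Re (cinner x x))"

instantiation complex :: complex_inner
begin

definition scaleC_complex :: "complex \<Rightarrow> complex \<Rightarrow> complex"
  where "scaleC_complex c x = c * x"

definition cinner_complex :: "complex \<Rightarrow> complex \<Rightarrow> complex"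
  where "cinner_complex x y = x * cnj y"

instance
  by standard
    (auto simp: scaleC_complex_def cinner_complex_def algebra_simps)

end

end

theory Submission
  imports Defs
begin

text \<open>
  Put \<open>c\<^sub>i = (r\<^sup>2\<parallel>x\<^sub>i\<parallel>\<^sup>2 - p\<^sup>2 + s\<^sup>2) / (2rs\<parallel>x\<^sub>i\<parallel>)\<close>. Squaring the condition \<open>x\<^sub>i \<in> D\<close> gives
  \<open>c\<^sub>i \<le> Re \<langle>u\<^sub>i, a\<rangle>\<close> for \<open>u\<^sub>i = x\<^sub>i / \<parallel>x\<^sub>i\<parallel>\<close>, and \<open>c\<^sub>i \<ge> 0\<close> because \<open>p \<le> s\<close>. With
  \<open>c = min c\<^sub>1 c\<^sub>2\<close>, the Schwarz inequality for \<open>u\<^sub>1 + u\<^sub>2\<close> and \<open>a\<close> yields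
  \<open>2 + 2 Re \<langle>u\<^sub>1, u\<^sub>2\<rangle> \<ge> 4c\<^sup>2\<close>; together with \<open>4\<parallel>x\<^sub>1\<parallel>\<parallel>x\<^sub>2\<parallel> \<le> (\<parallel>x\<^sub>1\<parallel> + \<parallel>x\<^sub>2\<parallel>)\<^sup>2\<close> this is the claim
  for the index attaining the minimum.
\<close>

text \<open>
  In the next two lemmas \<open>m\<close>, \<open>n\<close> stand for the norms of \<open>x\<^sub>1\<close>, \<open>x\<^sub>2\<close>, and \<open>q\<close>, \<open>t\<close>, \<open>u\<close> for the
  real parts of \<open>\<langle>x\<^sub>1, x\<^sub>2\<rangle>\<close>, \<open>\<langle>x\<^sub>1, a\<rangle>\<close>, \<open>\<langle>x\<^sub>2, a\<rangle>\<close>, so that they apply to real and complex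
  spaces alike. The hypothesis on \<open>n * t + m * u\<close> is the Schwarz inequality for
  \<open>n x\<^sub>1 + m x\<^sub>2\<close> and \<open>a\<close>.
\<close>

lemma defect_ratio_le:
  fixes m n q t u c :: real
  assumes "m > 0" "n > 0" "c \<ge> 0" "c * m \<le> t" "c * n \<le> u"
    and schwarz: "(n * t + m * u)\<^sup>2 \<le> 2 * (m * n) * (m * n + q)"
    and "q \<le> m * n"
  shows "(m * n - q) / (m + n)\<^sup>2 \<le> 1 / 2 * (1 - c\<^sup>2)"
proof -
  have mn: "m * n > 0" using assms by simp
  have "n * (c * m) + m * (c * n) \<le> n * t + m * u"
    using assms by (intro add_mono mult_left_mono) auto
  then have "2 * c * (m * n) \<le> n * t + m * u" by (simp add: algebra_simps)
  moreover have "0 \<le> 2 * c * (m * n)" using assms by simp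
  ultimately have "(2 * c * (m * n))\<^sup>2 \<le> (n * t + m * u)\<^sup>2" by (rule power_mono)
  also note schwarz
  finally have "(2 * (m * n)) * (2 * c\<^sup>2 * (m * n)) \<le> (2 * (m * n)) * (m * n + q)"
    by (simp add: power2_eq_square algebra_simps)
  then have "2 * c\<^sup>2 * (m * n) \<le> m * n + q"
    by (rule mult_left_le_imp_le) (use mn in simp)
  then have le: "m * n - q \<le> 2 * (1 - c\<^sup>2) * (m * n)"
    by (simp add: algebra_simps)
  \<comment> \<open>The left side of \<open>le\<close> is nonnegative, which forces
    \<open>c\<^sup>2 \<le> 1\<close>. This sign is what permits multiplying
    \<open>4 * (m * n) \<le> (m + n)\<^sup>2\<close> by \<open>1 - c\<^sup>2\<close> below.\<close>
  then have "0 \<le> (1 - c\<^sup>2) * (2 * (m * n))" using \<open>q \<le> m * n\<close> by (simp add: algebra_simps)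
  then have "0 \<le> 1 - c\<^sup>2" using mn by (simp add: zero_le_mult_iff)
  moreover have "4 * (m * n) \<le> (m + n)\<^sup>2"
    using zero_le_power2[of "m - n"] by (simp add: power2_eq_square algebra_simps)
  ultimately have "(1 - c\<^sup>2) * (4 * (m * n)) \<le> (1 - c\<^sup>2) * (m + n)\<^sup>2" by (rule mult_left_mono[rotated])
  then have "m * n - q \<le> 1 / 2 * (1 - c\<^sup>2) * (m + n)\<^sup>2" using le by linarith
  then show ?thesis using assms by (simp add: pos_divide_le_eq)
qed

lemma defect_ratio_disj:
  fixes m n q t u r s p :: real
  assumes "r > 0" "s > 0" "p \<in> {0<..s}" "m > 0" "n > 0"
    and t: "r\<^sup>2 * m\<^sup>2 - 2 * r * s * t + s\<^sup>2 \<le> p\<^sup>2"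
    and u: "r\<^sup>2 * n\<^sup>2 - 2 * r * s * u + s\<^sup>2 \<le> p\<^sup>2"
    and schwarz: "(n * t + m * u)\<^sup>2 \<le> 2 * (m * n) * (m * n + q)"
    and "q \<le> m * n"
  shows "(m * n - q) / (m + n)\<^sup>2 \<le> 1 / 2 * (1 - ((r\<^sup>2 * m\<^sup>2 - p\<^sup>2 + s\<^sup>2) / (2 * r * s * m))\<^sup>2)
    \<or> (m * n - q) / (m + n)\<^sup>2 \<le> 1 / 2 * (1 - ((r\<^sup>2 * n\<^sup>2 - p\<^sup>2 + s\<^sup>2) / (2 * r * s * n))\<^sup>2)"
proof -
  define c where "c = (\<lambda>k. (r\<^sup>2 * k\<^sup>2 - p\<^sup>2 + s\<^sup>2) / (2 * r * s * k))"
  have "p\<^sup>2 \<le> s\<^sup>2" using assms by (auto intro: power_mono)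
  then have nonneg: "0 \<le> r\<^sup>2 * k\<^sup>2 - p\<^sup>2 + s\<^sup>2" for k
    using mult_nonneg_nonneg[OF zero_le_power2 zero_le_power2, of r k] by linarith
  have c0: "0 \<le> c k" if "k > 0" for k
    unfolding c_def using nonneg[of k] that assms by simp
  have ck: "c k * k \<le> v" if "k > 0" "r\<^sup>2 * k\<^sup>2 - 2 * r * s * v + s\<^sup>2 \<le> p\<^sup>2" for k v
  proof -
    have "c k * k = (r\<^sup>2 * k\<^sup>2 - p\<^sup>2 + s\<^sup>2) / (2 * r * s)"
      using that by (simp add: c_def)
    also have "\<dots> \<le> v"
      using that assms by (simp add: pos_divide_le_eq algebra_simps)
    finally show ?thesis .
  qed
  define d where "d = min (c m) (c n)"
  have "d * m \<le> c m * m" "d * n \<le> c n * n"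
    using assms by (auto simp: d_def)
  then have "d * m \<le> t" "d * n \<le> u"
    using ck[OF \<open>m > 0\<close> t] ck[OF \<open>n > 0\<close> u] by linarith+
  moreover have "0 \<le> d" using c0 assms by (simp add: d_def)
  ultimately have "(m * n - q) / (m + n)\<^sup>2 \<le> 1 / 2 * (1 - d\<^sup>2)"
    using assms by (intro defect_ratio_le) auto
  moreover have "d = c m \<or> d = c n" by (auto simp: d_def min_def)
  ultimately show ?thesis unfolding c_def by metis
qed

lemma real_defect_ratio:
  fixes a x y :: "'a::real_inner"
  assumes "r > 0" "s > 0" "p \<in> {0<..s}" and a: "norm a = 1"
    and x: "norm (r *\<^sub>R x - s *\<^sub>R a) \<le> p" and y: "norm (r *\<^sub>R y - s *\<^sub>R a) \<le> p"
    and "x \<noteq> 0" "y \<noteq> 0"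
  shows "(norm x * norm y - inner x y) / (norm x + norm y)\<^sup>2
      \<le> 1 / 2 * (1 - ((r\<^sup>2 * (norm x)\<^sup>2 - p\<^sup>2 + s\<^sup>2) / (2 * r * s * norm x))\<^sup>2)
    \<or> (norm x * norm y - inner x y) / (norm x + norm y)\<^sup>2
      \<le> 1 / 2 * (1 - ((r\<^sup>2 * (norm y)\<^sup>2 - p\<^sup>2 + s\<^sup>2) / (2 * r * s * norm y))\<^sup>2)"
proof (rule defect_ratio_disj[where t = "inner x a" and u = "inner y a"])
  have aa: "inner a a = 1" using a by (simp add: norm_eq_1)
  have expand: "r\<^sup>2 * (norm z)\<^sup>2 - 2 * r * s * inner z a + s\<^sup>2 \<le> p\<^sup>2"
    if "norm (r *\<^sub>R z - s *\<^sub>R a) \<le> p" for z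
  proof -
    have "r\<^sup>2 * (norm z)\<^sup>2 - 2 * r * s * inner z a + s\<^sup>2 = (norm (r *\<^sub>R z - s *\<^sub>R a))\<^sup>2"
      unfolding power2_norm_eq_inner
      by (simp add: inner_diff inner_commute aa power2_eq_square algebra_simps)
    also have "\<dots> \<le> p\<^sup>2" using that by (intro power_mono) auto
    finally show ?thesis .
  qed
  show "r\<^sup>2 * (norm x)\<^sup>2 - 2 * r * s * inner x a + s\<^sup>2 \<le> p\<^sup>2" by (rule expand[OF x])
  show "r\<^sup>2 * (norm y)\<^sup>2 - 2 * r * s * inner y a + s\<^sup>2 \<le> p\<^sup>2" by (rule expand[OF y])
  \<comment> \<open>This is the sum of the two normalized vectors, scaled by
    \<open>norm x * norm y\<close> to avoid division. Both summands have the same norm, so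
    \<open>inner ?z ?z\<close> factors.\<close>
  let ?z = "norm y *\<^sub>R x + norm x *\<^sub>R y"
  have "(norm y * inner x a + norm x * inner y a)\<^sup>2 = (inner ?z a)\<^sup>2"
    by (simp add: inner_add)
  also have "\<dots> \<le> inner ?z ?z"
    using Cauchy_Schwarz_ineq[of ?z a] by (simp add: aa)
  also have "\<dots> = (norm y)\<^sup>2 * inner x x + 2 * (norm x * norm y) * inner x y + (norm x)\<^sup>2 * inner y y"
    by (simp add: inner_add inner_commute power2_eq_square algebra_simps)
  also have "\<dots> = 2 * (norm x * norm y) * (norm x * norm y + inner x y)"
    unfolding power2_norm_eq_inner[symmetric] by (simp add: power2_eq_square algebra_simps)
  finally show "(norm y * inner x a + norm x * inner y a)\<^sup>2
      \<le> 2 * (norm x * norm y) * (norm x * norm y + inner x y)" .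
qed (use assms norm_cauchy_schwarz[of x y] in auto)

lemma cnorm_square: "(cnorm x)\<^sup>2 = Re (cinner x x)"
  by (simp add: cnorm_def cinner_ge_zero)

lemma cnorm_nonneg: "0 \<le> cnorm x"
  by (simp add: cnorm_def cinner_ge_zero)

lemma Re_cinner_commute: "Re (cinner x y) = Re (cinner y x)"
  by (subst cinner_commute) simp

text \<open>Definiteness concerns the complex number \<open>cinner x x\<close>, while
  \<open>cnorm\<close> sees only its real part; conjugate symmetry makes the imaginary part
  vanish.\<close>

lemma cnorm_pos:
  assumes "x \<noteq> 0"
  shows "0 < cnorm x"
proof -
  have "cinner x x = cnj (cinner x x)" by (rule cinner_commute)
  then have "Im (cinner x x) = 0" by (simp add: complex_eq_iff)
  with assms have "Re (cinner x x) \<noteq> 0"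
    using cinner_eq_zero_iff[of x] by (auto simp: complex_eq_iff)
  then show ?thesis
    using cinner_ge_zero[of x] by (simp add: cnorm_def)
qed

text \<open>\<open>0 *\<^sub>C x\<close> equals its own double, hence is zero, and it is also the
  sum of \<open>(- 1) *\<^sub>C x\<close> and \<open>x\<close>.\<close>

lemma scaleC_minus1: "- x = (- 1) *\<^sub>C (x :: 'a::complex_inner)"
proof -
  have "0 *\<^sub>C x + 0 *\<^sub>C x = 0 *\<^sub>C x" by (simp flip: scaleC_add_left)
  then have "0 *\<^sub>C x = 0" by simp
  moreover have "(- 1) *\<^sub>C x + 1 *\<^sub>C x = 0 *\<^sub>C x" by (simp flip: scaleC_add_left)
  ultimately show ?thesis by (metis scaleC_one eq_neg_iff_add_eq_0)
qed

lemma Re_cinner_lincomb_left: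
  "Re (cinner (complex_of_real b *\<^sub>C x + complex_of_real c *\<^sub>C y) z) =
    b * Re (cinner x z) + c * Re (cinner y z)"
  by (simp add: cinner_add_left cinner_scaleC_left)

text \<open>For real coefficients, \<open>Re (cinner x y)\<close> acts as a symmetric bilinear form.
  Every quadratic expansion in the complex case is an instance of this identity.\<close>

lemma Re_cinner_lincomb:
  "Re (cinner (complex_of_real b *\<^sub>C x + complex_of_real c *\<^sub>C y)
      (complex_of_real b *\<^sub>C x + complex_of_real c *\<^sub>C y)) =
    b\<^sup>2 * (cnorm x)\<^sup>2 + 2 * b * c * Re (cinner x y) + c\<^sup>2 * (cnorm y)\<^sup>2"
proof -
  let ?w = "complex_of_real b *\<^sub>C x + complex_of_real c *\<^sub>C y"
  have "Re (cinner z ?w) = b * Re (cinner z x) + c * Re (cinner z y)" for z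
    by (simp only: Re_cinner_commute[of z] Re_cinner_lincomb_left)
  then show ?thesis
    unfolding cnorm_square
    by (simp add: Re_cinner_lincomb_left Re_cinner_commute[of y x]
        power2_eq_square algebra_simps)
qed

text \<open>Brings the difference defining the ball \<open>D\<close> into the form expected by
  \<open>Re_cinner_lincomb\<close>.\<close>

lemma diff_scaleC:
  "complex_of_real b *\<^sub>C x - complex_of_real c *\<^sub>C y =
    complex_of_real b *\<^sub>C x + complex_of_real (- c) *\<^sub>C (y :: 'a::complex_inner)"
  by (simp add: diff_conv_add_uminus scaleC_minus1[of "complex_of_real c *\<^sub>C y"] scaleC_scaleC
      del: add_uminus_conv_diff)

lemma complex_Cauchy_Schwarz_unit:
  assumes "cnorm a = 1"
  shows "(Re (cinner z a))\<^sup>2 \<le> (cnorm z)\<^sup>2"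
proof -
  let ?t = "Re (cinner z a)"
  \<comment> \<open>The squared norm of \<open>z\<close> minus \<open>?t\<close> times
    \<open>a\<close>; the coefficient \<open>?t\<close> minimizes it among real multiples of the
    unit vector \<open>a\<close>.\<close>
  have "0 \<le> 1\<^sup>2 * (cnorm z)\<^sup>2 + 2 * 1 * (- ?t) * ?t + (- ?t)\<^sup>2 * (cnorm a)\<^sup>2"
    unfolding Re_cinner_lincomb[symmetric] by (rule cinner_ge_zero)
  then show ?thesis by (simp add: assms power2_eq_square)
qed

lemma Re_cinner_le:
  assumes "x \<noteq> 0" "y \<noteq> 0"
  shows "Re (cinner x y) \<le> cnorm x * cnorm y"
proof -
  let ?m = "cnorm x" and ?n = "cnorm y"
  \<comment> \<open>The squared norm of \<open>?n\<close> times \<open>x\<close> minus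
    \<open>?m\<close> times \<open>y\<close>, two vectors of equal norm. It factors through
    \<open>2 * ?m * ?n\<close>, which is positive because \<open>x\<close> and \<open>y\<close> are
    nonzero.\<close>
  have "0 \<le> ?n\<^sup>2 * ?m\<^sup>2 + 2 * ?n * (- ?m) * Re (cinner x y) + (- ?m)\<^sup>2 * ?n\<^sup>2"
    unfolding Re_cinner_lincomb[symmetric] by (rule cinner_ge_zero)
  then have "(2 * ?m * ?n) * Re (cinner x y) \<le> (2 * ?m * ?n) * (?m * ?n)"
    by (simp add: power2_eq_square algebra_simps)
  then show ?thesis using cnorm_pos[OF assms(1)] cnorm_pos[OF assms(2)] by simp
qed

text \<open>The argument of \<open>real_defect_ratio\<close> carries over with
  \<open>Re (cinner x y)\<close> in place of \<open>inner x y\<close>, since only real scalars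
  occur.\<close>

lemma complex_defect_ratio:
  fixes a x y :: "'a::complex_inner"
  assumes "r > 0" "s > 0" "p \<in> {0<..s}" and a: "cnorm a = 1"
    and x: "cnorm (complex_of_real r *\<^sub>C x - complex_of_real s *\<^sub>C a) \<le> p"
    and y: "cnorm (complex_of_real r *\<^sub>C y - complex_of_real s *\<^sub>C a) \<le> p"
    and "x \<noteq> 0" "y \<noteq> 0"
  shows "(cnorm x * cnorm y - Re (cinner x y)) / (cnorm x + cnorm y)\<^sup>2
      \<le> 1 / 2 * (1 - ((r\<^sup>2 * (cnorm x)\<^sup>2 - p\<^sup>2 + s\<^sup>2) / (2 * r * s * cnorm x))\<^sup>2)
    \<or> (cnorm x * cnorm y - Re (cinner x y)) / (cnorm x + cnorm y)\<^sup>2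
      \<le> 1 / 2 * (1 - ((r\<^sup>2 * (cnorm y)\<^sup>2 - p\<^sup>2 + s\<^sup>2) / (2 * r * s * cnorm y))\<^sup>2)"
proof (rule defect_ratio_disj[where t = "Re (cinner x a)" and u = "Re (cinner y a)"])
  have expand: "r\<^sup>2 * (cnorm z)\<^sup>2 - 2 * r * s * Re (cinner z a) + s\<^sup>2 \<le> p\<^sup>2"
    if "cnorm (complex_of_real r *\<^sub>C z - complex_of_real s *\<^sub>C a) \<le> p" for z
  proof -
    have "r\<^sup>2 * (cnorm z)\<^sup>2 - 2 * r * s * Re (cinner z a) + s\<^sup>2 =
        (cnorm (complex_of_real r *\<^sub>C z - complex_of_real s *\<^sub>C a))\<^sup>2"
      unfolding diff_scaleC cnorm_square[of "_ + _"] Re_cinner_lincomb by (simp add: a)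
    also have "\<dots> \<le> p\<^sup>2" using that by (intro power_mono cnorm_nonneg)
    finally show ?thesis .
  qed
  show "r\<^sup>2 * (cnorm x)\<^sup>2 - 2 * r * s * Re (cinner x a) + s\<^sup>2 \<le> p\<^sup>2" by (rule expand[OF x])
  show "r\<^sup>2 * (cnorm y)\<^sup>2 - 2 * r * s * Re (cinner y a) + s\<^sup>2 \<le> p\<^sup>2" by (rule expand[OF y])
  let ?z = "complex_of_real (cnorm y) *\<^sub>C x + complex_of_real (cnorm x) *\<^sub>C y"
  have "(cnorm y * Re (cinner x a) + cnorm x * Re (cinner y a))\<^sup>2 = (Re (cinner ?z a))\<^sup>2"
    by (simp only: Re_cinner_lincomb_left)
  also have "\<dots> \<le> Re (cinner ?z ?z)"
    unfolding cnorm_square[symmetric] by (rule complex_Cauchy_Schwarz_unit[OF a])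
  also have "\<dots> = 2 * (cnorm x * cnorm y) * (cnorm x * cnorm y + Re (cinner x y))"
    unfolding Re_cinner_lincomb by (simp add: power2_eq_square algebra_simps)
  finally show "(cnorm y * Re (cinner x a) + cnorm x * Re (cinner y a))\<^sup>2
      \<le> 2 * (cnorm x * cnorm y) * (cnorm x * cnorm y + Re (cinner x y))" .
qed (use assms cnorm_pos Re_cinner_le in auto)

theorem theorem3p1:
  fixes r s p :: real
  assumes "r > 0" and "s > 0" and "p \<in> {0<..s}"
  shows
    "(\<forall>(a::'a::real_inner) D x1 x2.
        norm a = 1 \<longrightarrow>
        D = {x. norm (r *\<^sub>R x - s *\<^sub>R a) \<le> p} \<longrightarrow>
        x1 \<in> D \<longrightarrow> x2 \<in> D \<longrightarrow> x1 \<noteq> 0 \<longrightarrow> x2 \<noteq> 0 \<longrightarrow>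
          (norm x1 * norm x2 - inner x1 x2) / (norm x1 + norm x2)\<^sup>2
            \<le> 1 / 2 * (1 - ((r\<^sup>2 * (norm x1)\<^sup>2 - p\<^sup>2 + s\<^sup>2) / (2 * r * s * norm x1))\<^sup>2)
        \<or> (norm x1 * norm x2 - inner x1 x2) / (norm x1 + norm x2)\<^sup>2
            \<le> 1 / 2 * (1 - ((r\<^sup>2 * (norm x2)\<^sup>2 - p\<^sup>2 + s\<^sup>2) / (2 * r * s * norm x2))\<^sup>2))
     \<and>
     (\<forall>(a::'b::complex_inner) D x1 x2.
        cnorm a = 1 \<longrightarrow>
        D = {x. cnorm (complex_of_real r *\<^sub>C x - complex_of_real s *\<^sub>C a) \<le> p} \<longrightarrow>
        x1 \<in> D \<longrightarrow> x2 \<in> D \<longrightarrow> x1 \<noteq> 0 \<longrightarrow> x2 \<noteq> 0 \<longrightarrow>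
          (cnorm x1 * cnorm x2 - Re (cinner x1 x2)) / (cnorm x1 + cnorm x2)\<^sup>2
            \<le> 1 / 2 * (1 - ((r\<^sup>2 * (cnorm x1)\<^sup>2 - p\<^sup>2 + s\<^sup>2) / (2 * r * s * cnorm x1))\<^sup>2)
        \<or> (cnorm x1 * cnorm x2 - Re (cinner x1 x2)) / (cnorm x1 + cnorm x2)\<^sup>2
            \<le> 1 / 2 * (1 - ((r\<^sup>2 * (cnorm x2)\<^sup>2 - p\<^sup>2 + s\<^sup>2) / (2 * r * s * cnorm x2))\<^sup>2))"
  \<comment> \<open>\<open>hypsubst\<close> replaces \<open>D\<close> by its defining set, so that
    both memberships become the norm bounds required by the two lemmas.\<close>
  by (intro conjI allI impI; hypsubst; unfold mem_Collect_eq)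
    (intro real_defect_ratio complex_defect_ratio assms; assumption)+

end
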